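(* For every integer $m>1$ one can choose a (large enough) integer $N$ such that the space $F=\ell^3_N$ contains a linear subspace $E\subset F$ with $\dim F-\dim E=m$ for which $F$ has no linear subspace of dimension $m$ that is orthogonal to $E$.
   Context: $\ell^3_N$ is $\mathbb R^N$ with the norm $\|x\|=\left(\sum_{i=1}^N|x_i|^3\right)^{1/3}$. For linear subspaces $X_1,X_2$ of a normed space, $X_1$ is called orthogonal to $X_2$ if $\operatorname{dist}(x,X_2)=1$ for every $x\in X_1$ with $\|x\|=1$. (The relation is not symmetric in $X_1,X_2$.) *)

theory Defs
  imports "HOL-Analysis.Analysis" "HOL-Analysis.Finite_Function_Topology"
begin

text \<open>
  Since \<open>N\<close> has to be quantified inside a formula, \<open>\<real>\<^sup>N\<close> is modelled as the subspace of those
  finitely supported real sequences whose support lies in \<open>{1..N}\<close>.  The norm that the type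
  \<open>nat \<Rightarrow>\<^sub>0 real\<close> carries as an instance of \<^class>\<open>real_normed_vector\<close> is the 1-norm and is not
  used; only its \<^class>\<open>real_vector\<close> structure is.
\<close>

definition coord_space :: "nat \<Rightarrow> (nat \<Rightarrow>\<^sub>0 real) set" where
  "coord_space N = {x. Poly_Mapping.keys x \<subseteq> {1..N}}"

definition l3_norm :: "nat \<Rightarrow> (nat \<Rightarrow>\<^sub>0 real) \<Rightarrow> real" where
  "l3_norm N x = root 3 (\<Sum>i=1..N. \<bar>Poly_Mapping.lookup x i\<bar> ^ 3)"

definition dist_to :: "('a::real_vector \<Rightarrow> real) \<Rightarrow> 'a \<Rightarrow> 'a set \<Rightarrow> real" where
  "dist_to nrm x A = (INF y\<in>A. nrm (x - y))"

definition subspace_orthogonal :: "('a::real_vector \<Rightarrow> real) \<Rightarrow> 'a set \<Rightarrow> 'a set \<Rightarrow> bool" where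
  "subspace_orthogonal nrm X1 X2 \<longleftrightarrow> (\<forall>x\<in>X1. nrm x = 1 \<longrightarrow> dist_to nrm x X2 = 1)"

lemma lookup_scaleR_poly_mapping:
  "Poly_Mapping.lookup (c *\<^sub>R x) i = c *\<^sub>R Poly_Mapping.lookup (x :: 'a \<Rightarrow>\<^sub>0 'b::real_vector) i"
proof -
  have "{i. c *\<^sub>R Poly_Mapping.lookup x i \<noteq> 0} \<subseteq> Poly_Mapping.keys x"
    by (auto simp: in_keys_iff)
  then have "finite {i. c *\<^sub>R Poly_Mapping.lookup x i \<noteq> 0}"
    by (rule finite_subset) simp
  then show ?thesis
    by (simp add: scaleR_poly_mapping_def Abs_poly_mapping_inverse)
qed

lemma subspace_coord_space: "subspace (coord_space N)"
  unfolding coord_space_def subspace_def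
  by (auto simp: in_keys_iff lookup_add lookup_scaleR_poly_mapping subset_iff)
    (metis add.right_neutral)+

lemma dim_coord_space: "dim (coord_space N) = N"
proof -
  let ?e = "\<lambda>i. Poly_Mapping.single i (1::real)"
  let ?B = "?e ` {1..N}"
  have inj: "inj_on ?e A" for A :: "nat set"
    by (rule inj_onI) (metis lookup_single_eq lookup_single_not_eq zero_neq_one)
  have lookup_sum_e: "Poly_Mapping.lookup (\<Sum>i\<in>A. u i *\<^sub>R ?e i) j = (if j \<in> A then u j else 0)"
    if "finite A" for A :: "nat set" and u j
    using that by (simp add: lookup_sum lookup_scaleR_poly_mapping lookup_single when_def
        if_distrib[of "\<lambda>x. _ * x"] cong: if_cong)
  have sub: "?B \<subseteq> coord_space N"
    by (auto simp: coord_space_def)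
  have "coord_space N \<subseteq> span ?B"
  proof
    fix x assume x: "x \<in> coord_space N"
    have "x = (\<Sum>i\<in>{1..N}. Poly_Mapping.lookup x i *\<^sub>R ?e i)"
      using x by (intro poly_mapping_eqI) (auto simp: lookup_sum_e coord_space_def in_keys_iff)
    also have "\<dots> \<in> span ?B"
      by (intro span_sum span_scale span_base) auto
    finally show "x \<in> span ?B" .
  qed
  moreover have "independent ?B"
  proof (rule independent_if_scalars_zero)
    fix f x assume s: "(\<Sum>x\<in>?B. f x *\<^sub>R x) = 0" and "x \<in> ?B"
    then obtain j where j: "x = ?e j" "j \<in> {1..N}" by blast
    have "(\<Sum>i\<in>{1..N}. f (?e i) *\<^sub>R ?e i) = 0"
      using s by (simp add: sum.reindex[OF inj])
    then have "Poly_Mapping.lookup (\<Sum>i\<in>{1..N}. f (?e i) *\<^sub>R ?e i) j = 0" by simp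
    then show "f x = 0" using j by (simp add: lookup_sum_e)
  qed simp
  moreover have "card ?B = N"
    by (simp add: card_image[OF inj])
  ultimately show ?thesis
    using sub by (intro dim_unique)
qed

end

theory Submission
  imports Defs
begin

text \<open>
  Take \<open>N = m + 1\<close> and let \<open>E\<close> be the line spanned by \<open>v = (1, 1, -1, 0, \<dots>, 0)\<close>.  If \<open>x\<close> lies in a
  subspace orthogonal to \<open>E\<close>, then \<open>t \<mapsto> \<parallel>x - t v\<parallel>\<close> is minimal at \<open>t = 0\<close>.  A hyperplane \<open>G\<close> orthogonal
  to \<open>E\<close> meets the \<open>(1,3)\<close>-coordinate plane in a nonzero vector, which by minimality is a multiple
  of \<open>(1, 0, 1, 0, \<dots>)\<close>; likewise it contains \<open>(0, 1, 1, 0, \<dots>)\<close>.  But then it contains the sum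
  \<open>(1, 1, 2, 0, \<dots>)\<close>, for which \<open>t = 0\<close> is not minimal.
\<close>

text \<open>\<open>G\<close> has codimension one in \<open>V\<close>. If \<open>u\<close> is outside
  \<open>G\<close>, then \<open>w\<close> lies in the span of \<open>G\<close> and \<open>u\<close>:
  otherwise a basis of \<open>G\<close> together with \<open>u\<close> and \<open>w\<close> would be
  \<open>dim G + 2\<close> independent vectors in \<open>V\<close>.\<close>

lemma hyperplane_meets_plane:
  fixes G V :: "'a::real_vector set"
  assumes G: "subspace G" "G \<subseteq> V" and dims: "dim V = Suc (dim G)" "dim G > 0"
    and uw: "u \<in> V" "w \<in> V"
  obtains a b where "(a, b) \<noteq> (0, 0)" "a *\<^sub>R u + b *\<^sub>R w \<in> G"
proof -
  obtain B where B: "B \<subseteq> G" "independent B" "G \<subseteq> span B" "card B = dim G"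
    using basis_exists[of G] by metis
  obtain C where C: "V \<subseteq> span C" "card C = dim V"
    using basis_exists[of V] by metis
  \<comment> \<open>Infinite sets have \<open>card\<close> 0, so positive dimensions force both sets
    to be finite.\<close>
  have fin: "finite B" "finite C"
    using B C dims by (auto intro: card_ge_0_finite)
  have span_B: "span B = G"
    using B G by (metis span_minimal subset_antisym)
  show ?thesis
  proof (cases "u \<in> span B")
    case True
    then show ?thesis using span_B by (intro that[of 1 0]) auto
  next
    case u: False
    have "w \<in> span (insert u B)"
    proof (rule ccontr)
      assume w: "w \<notin> span (insert u B)"
      have "independent (insert w (insert u B))"
        using u w B by (simp add: independent_insertI)
      moreover have "insert w (insert u B) \<subseteq> span C"
        using uw B G C by auto
      ultimately have "card (insert w (insert u B)) \<le> card C"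
        using independent_span_bound fin by blast
      moreover have "w \<notin> insert u B" "u \<notin> B"
        using u w span_base by blast+
      ultimately show False using fin B C dims by simp
    qed
    then obtain k where "w - k *\<^sub>R u \<in> span B"
      by (auto simp: span_breakdown_eq)
    then show ?thesis using span_B by (intro that[of "-k" 1]) auto
  qed
qed

lemma l3_norm_nonneg: "0 \<le> l3_norm N x"
  by (simp add: l3_norm_def sum_nonneg)

lemma l3_norm_scaleR: "l3_norm N (c *\<^sub>R x) = \<bar>c\<bar> * l3_norm N x"
  by (simp add: l3_norm_def lookup_scaleR_poly_mapping abs_mult power_mult_distrib
      real_root_mult real_root_power_cancel flip: sum_distrib_left)

text \<open>Scaling by \<open>c\<close> brings \<open>x\<close> to norm one, where the infimum
  equals 1 and is at most the value at \<open>c *\<^sub>R y\<close>; dividing by \<open>c\<close>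
  gives the claim. Norm zero is covered by nonnegativity.\<close>

lemma subspace_orthogonal_l3_normD:
  assumes orth: "subspace_orthogonal (l3_norm N) G E" and "subspace G" "subspace E"
    and x: "x \<in> G" and y: "y \<in> E"
  shows "l3_norm N x \<le> l3_norm N (x - y)"
proof (cases "l3_norm N x = 0")
  case True
  then show ?thesis by (simp add: l3_norm_nonneg)
next
  case False
  define c where "c = inverse (l3_norm N x)"
  have c: "c > 0" using False l3_norm_nonneg[of N x] by (simp add: c_def)
  have "c *\<^sub>R x \<in> G" "c *\<^sub>R y \<in> E"
    using assms by (auto intro: subspace_scale)
  moreover have "l3_norm N (c *\<^sub>R x) = 1"
    using c False by (simp add: l3_norm_scaleR) (simp add: c_def)
  ultimately have "1 = (INF z\<in>E. l3_norm N (c *\<^sub>R x - z))"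
    using orth by (simp add: subspace_orthogonal_def dist_to_def)
  also have "\<dots> \<le> l3_norm N (c *\<^sub>R x - c *\<^sub>R y)"
    by (rule cINF_lower) (auto intro!: bdd_belowI[of _ 0] simp: l3_norm_nonneg \<open>c *\<^sub>R y \<in> E\<close>)
  also have "\<dots> = c * l3_norm N (x - y)"
    using c by (simp add: l3_norm_scaleR flip: scaleR_diff_right)
  finally show ?thesis
    using False l3_norm_nonneg[of N x] by (simp add: c_def field_simps)
qed

definition vec3 :: "real \<Rightarrow> real \<Rightarrow> real \<Rightarrow> nat \<Rightarrow>\<^sub>0 real" where
  "vec3 a b c = Poly_Mapping.single 1 a + Poly_Mapping.single 2 b + Poly_Mapping.single 3 c"

lemma lookup_vec3:
  "Poly_Mapping.lookup (vec3 a b c) i = (if i = 1 then a else if i = 2 then b else if i = 3 then c else 0)"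
  by (auto simp: vec3_def lookup_add lookup_single when_def)

lemma vec3_add: "vec3 a b c + vec3 a' b' c' = vec3 (a + a') (b + b') (c + c')"
  by (rule poly_mapping_eqI) (simp add: lookup_vec3 lookup_add)

lemma vec3_diff: "vec3 a b c - vec3 a' b' c' = vec3 (a - a') (b - b') (c - c')"
  by (rule poly_mapping_eqI) (simp add: lookup_vec3 lookup_minus)

lemma vec3_scaleR: "r *\<^sub>R vec3 a b c = vec3 (r * a) (r * b) (r * c)"
  by (rule poly_mapping_eqI) (simp add: lookup_vec3 lookup_scaleR_poly_mapping)

lemma vec3_in_coord_space: "N \<ge> 3 \<Longrightarrow> vec3 a b c \<in> coord_space N"
  by (auto simp: coord_space_def in_keys_iff lookup_vec3 split: if_splits)

lemma l3_norm_vec3: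
  assumes "N \<ge> 3"
  shows "l3_norm N (vec3 a b c) = root 3 (\<bar>a\<bar> ^ 3 + \<bar>b\<bar> ^ 3 + \<bar>c\<bar> ^ 3)"
proof -
  have "(\<Sum>i=1..N. \<bar>Poly_Mapping.lookup (vec3 a b c) i\<bar> ^ 3)
      = (\<Sum>i\<in>{1,2,3}. \<bar>Poly_Mapping.lookup (vec3 a b c) i\<bar> ^ 3)"
    using assms by (intro sum.mono_neutral_right) (auto simp: lookup_vec3)
  then show ?thesis by (simp add: l3_norm_def lookup_vec3)
qed

text \<open>Neither \<open>s + d\<close> nor \<open>s - d\<close> has sign opposite to
  \<open>s\<close>, so all absolute values open alike and the odd powers of \<open>d\<close>
  cancel.\<close>

lemma abs_cube_add_diff:
  fixes s d :: real
  assumes "\<bar>d\<bar> \<le> \<bar>s\<bar>"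
  shows "\<bar>s + d\<bar> ^ 3 + \<bar>s - d\<bar> ^ 3 = 2 * \<bar>s\<bar> ^ 3 + 6 * \<bar>s\<bar> * d\<^sup>2"
proof (cases "s \<ge> 0")
  case True
  then have "\<bar>s + d\<bar> = s + d" "\<bar>s - d\<bar> = s - d" "\<bar>s\<bar> = s" using assms by auto
  then show ?thesis by (simp add: algebra_simps power2_eq_square power3_eq_cube)
next
  case False
  then have "\<bar>s + d\<bar> = - (s + d)" "\<bar>s - d\<bar> = d - s" "\<bar>s\<bar> = - s" using assms by auto
  then show ?thesis by (simp add: algebra_simps power2_eq_square power3_eq_cube)
qed

text \<open>The hypothesis compares \<open>t = 0\<close> with \<open>t = d\<close> for \<open>x = (s + d, 0, s - d)\<close>.\<close>

lemma abs_cube_midpoint_zero: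
  fixes s d :: real
  assumes le: "\<bar>s + d\<bar> ^ 3 + \<bar>s - d\<bar> ^ 3 \<le> 2 * \<bar>s\<bar> ^ 3 + \<bar>d\<bar> ^ 3"
  shows "d = 0"
proof (cases "\<bar>d\<bar> \<le> \<bar>s\<bar>")
  case True
  \<comment> \<open>Expanding \<open>le\<close> gives \<open>6|s|d^2 <= |d|^3\<close>, hence
    \<open>6|d|^3 <= |d|^3\<close>.\<close>
  have "\<bar>d\<bar> * \<bar>d\<bar>\<^sup>2 \<le> \<bar>s\<bar> * \<bar>d\<bar>\<^sup>2"
    using True by (intro mult_right_mono) auto
  then have "\<bar>d\<bar> ^ 3 \<le> 0"
    using le abs_cube_add_diff[OF True] zero_le_power[of "\<bar>d\<bar>" 3]
    by (simp add: power2_eq_square power3_eq_cube)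
  then show ?thesis by simp
next
  case False
  then have ds: "\<bar>s\<bar> \<le> \<bar>d\<bar>" by simp
  \<comment> \<open>Expanding with \<open>s\<close> and \<open>d\<close> exchanged gives
    \<open>|d|^3 + 6|d|s^2 <= 2|s|^3 <= 2|d|s^2\<close>.\<close>
  have "\<bar>s\<bar> * \<bar>s\<bar>\<^sup>2 \<le> \<bar>d\<bar> * \<bar>s\<bar>\<^sup>2"
    using ds by (intro mult_right_mono) auto
  then have "\<bar>d\<bar> ^ 3 \<le> 0"
    using le abs_cube_add_diff[OF ds] zero_le_power[of "\<bar>s\<bar>" 3]
    by (simp add: power2_eq_square power3_eq_cube add.commute abs_minus_commute mult_ac)
  then show ?thesis by simp
qed

theorem theorem7p3:
  fixes m :: nat
  assumes "m > 1"
  shows "\<exists>N. \<exists>E. subspace E \<and> E \<subseteq> coord_space N \<and>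
           dim (coord_space N) = dim E + m \<and>
           \<not> (\<exists>G. subspace G \<and> G \<subseteq> coord_space N \<and> dim G = m \<and>
                  subspace_orthogonal (l3_norm N) G E)"
proof -
  \<comment> \<open>With \<open>E\<close> a line, codimension \<open>m\<close> means
    \<open>N = m + 1\<close>; \<open>m > 1\<close> then leaves room for three coordinates.\<close>
  define N where "N = Suc m"
  define v where "v = vec3 1 1 (-1)"
  have N: "N \<ge> 3" using assms by (simp add: N_def)
  have "v \<noteq> 0"
    by (metis lookup_vec3 lookup_zero v_def zero_neq_one)
  then have "dim (span {v}) = 1"
    by (simp add: dim_eq_card_independent)
  then have dim_eq: "dim (coord_space N) = dim (span {v}) + m"
    by (simp add: dim_coord_space N_def)
  have E_sub: "span {v} \<subseteq> coord_space N"
    using N by (simp add: span_minimal subspace_coord_space vec3_in_coord_space v_def)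
  have False if G: "subspace G" "G \<subseteq> coord_space N" "dim G = m"
    and orth: "subspace_orthogonal (l3_norm N) G (span {v})" for G
  proof -
    have minimal: "\<bar>a\<bar> ^ 3 + \<bar>b\<bar> ^ 3 + \<bar>c\<bar> ^ 3 \<le> \<bar>a - t\<bar> ^ 3 + \<bar>b - t\<bar> ^ 3 + \<bar>c + t\<bar> ^ 3"
      if "vec3 a b c \<in> G" for a b c t
    proof -
      have "l3_norm N (vec3 a b c) \<le> l3_norm N (vec3 a b c - t *\<^sub>R v)"
        using G by (intro subspace_orthogonal_l3_normD[OF orth])
          (auto intro: that span_scale span_base)
      then show ?thesis
        by (simp add: v_def vec3_scaleR vec3_diff l3_norm_vec3[OF N])
    qed
    have meets: "\<exists>a b. (a, b) \<noteq> (0, 0) \<and> a *\<^sub>R x + b *\<^sub>R y \<in> G"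
      if "x \<in> coord_space N" "y \<in> coord_space N" for x y
      using hyperplane_meets_plane[of G "coord_space N" x y] G that assms
      by (metis N_def dim_coord_space less_trans zero_less_one)
    have normalize: "vec3 p q 1 \<in> G" if "a \<noteq> 0" "vec3 (a * p) (a * q) a \<in> G" for a p q
      using subspace_scale[OF G(1) that(2), of "inverse a"] that(1)
      by (simp add: vec3_scaleR mult.assoc[symmetric])
    have "vec3 1 0 1 \<in> G"
    proof -
      obtain a c where ac: "(a, c) \<noteq> (0, 0)" "vec3 a 0 c \<in> G"
        using meets[of "vec3 1 0 0" "vec3 0 0 1"] N
        by (auto simp: vec3_in_coord_space vec3_scaleR vec3_add)
      \<comment> \<open>Subtracting \<open>d *\<^sub>R v\<close> from \<open>(a, 0, c)\<close> gives
        \<open>(s, -d, s)\<close>: it averages the two outer entries at the cost of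
        \<open>|d|^3\<close>.\<close>
      define s d where "s = (a + c) / 2" and "d = (a - c) / 2"
      have sd: "a = s + d" "c = s - d" by (auto simp: s_def d_def field_simps)
      have "d = 0"
        using minimal[OF ac(2), of d] by (intro abs_cube_midpoint_zero[of s]) (simp add: sd)
      then show ?thesis using ac sd normalize[of s 1 0] by simp
    qed
    moreover have "vec3 0 1 1 \<in> G"
    proof -
      obtain b c where bc: "(b, c) \<noteq> (0, 0)" "vec3 0 b c \<in> G"
        using meets[of "vec3 0 1 0" "vec3 0 0 1"] N
        by (auto simp: vec3_in_coord_space vec3_scaleR vec3_add)
      \<comment> \<open>Here the subtraction turns \<open>(0, b, c)\<close> into
        \<open>(-d, s, s)\<close>, which leads to the same inequality.\<close>
      define s d where "s = (b + c) / 2" and "d = (b - c) / 2"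
      have sd: "b = s + d" "c = s - d" by (auto simp: s_def d_def field_simps)
      have "d = 0"
        using minimal[OF bc(2), of d] by (intro abs_cube_midpoint_zero[of s]) (simp add: sd)
      then show ?thesis using bc sd normalize[of s 0 1] by simp
    qed
    ultimately have "vec3 1 1 2 \<in> G"
      using subspace_add[OF G(1)] by (fastforce simp: vec3_add)
    \<comment> \<open>Minimality at \<open>t = 0\<close> requires \<open>a|a| + b|b| = c|c|\<close>,
      a nonlinear condition that fails for \<open>(1, 1, 2)\<close>. The derivative there is
      \<open>-3 - 3 + 12 > 0\<close>, so a small negative \<open>t\<close> lowers the sum: 10 drops
      to 9.521.\<close>
    from minimal[OF this, of "-1/10"] show False
      by (simp add: power3_eq_cube)
  qed
  then show ?thesis using dim_eq E_sub by blast
qed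

end
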